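(* Let $n,r,s$ be positive integers with $r\le n$, $s\le n$, and let $k$ be an integer. Consider an $n\times n$ array in which the cells of $A$, the subarray formed by rows $1,\ldots,r$ and columns $1,\ldots,s$, are filled with zeros and ones, and let $B$ denote the subarray formed by rows $r+1,\ldots,n$ and columns $1,\ldots,s$ (the cells of $B$ are initially unfilled). Suppose that each row of $A$ contains at least $s+k-n$ and at most $k$ ones, and each column of $A$ contains at least $r+k-n$ and at most $k$ ones. Let $a_0$ be the number of ones in $A$. If 1) $(r+s-n)k\le a_0$, and 2) $a_0\le rs-(n-k)(r+s-n)$, then the cells of $B$ can be filled with zeros and ones so that each column of the $n\times s$ array $A\cup B$ (rows $1,\ldots,n$, columns $1,\ldots,s$) contains exactly $k$ ones, and each row of $A\cup B$ contains at least $s+k-n$ and at most $k$ ones. *)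

theory Defs
  imports Main
begin

text \<open>
  An array is a function \<open>M\<close> of a row index and a column index, both counted from 1; only its
  values on the cells \<open>R \<times> C\<close> under consideration are relevant, cells outside being unfilled.
\<close>

definition zero_one_filled :: "(nat \<Rightarrow> nat \<Rightarrow> nat) \<Rightarrow> nat set \<Rightarrow> nat set \<Rightarrow> bool" where
  "zero_one_filled M R C \<longleftrightarrow> (\<forall>i\<in>R. \<forall>j\<in>C. M i j \<in> {0, 1})"

definition num_ones :: "(nat \<Rightarrow> nat \<Rightarrow> nat) \<Rightarrow> nat set \<Rightarrow> nat set \<Rightarrow> nat" where
  "num_ones M R C = card {(i, j). i \<in> R \<and> j \<in> C \<and> M i j = 1}"

end

theory Submission
  imports Defs
begin

text \<open>
  Column \<open>j\<close> of \<open>B\<close> must receive \<open>d\<^sub>j = k - c\<^sub>j\<close> ones, where \<open>c\<^sub>j\<close> is its number of ones in \<open>A\<close>, and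
  the column hypothesis says \<open>0 \<le> d\<^sub>j \<le> n - r\<close>. Place these ones cyclically in the \<open>n - r\<close> rows of
  \<open>B\<close>, each column starting where the previous one stopped. No cell is used twice, and the row
  sums of \<open>B\<close> are as equal as possible, so they all lie in \<open>[s + k - n, k]\<close> as soon as their total
  \<open>s k - a\<^sub>0\<close> lies between \<open>(n - r) (s + k - n)\<close> and \<open>(n - r) k\<close>. These two bounds are
  conditions 2 and 1.
\<close>

lemma num_ones_eq_sum:
  assumes "zero_one_filled M R C" "finite R" "finite C"
  shows "num_ones M R C = (\<Sum>i\<in>R. \<Sum>j\<in>C. M i j)"
proof -
  have "{(i, j). i \<in> R \<and> j \<in> C \<and> M i j = 1} = (SIGMA i:R. {j\<in>C. M i j = 1})"
    by auto
  then have "num_ones M R C = (\<Sum>i\<in>R. card {j\<in>C. M i j = 1})"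
    unfolding num_ones_def using assms by simp
  also have "\<dots> = (\<Sum>i\<in>R. \<Sum>j\<in>C. M i j)"
  proof (rule sum.cong[OF refl])
    fix i assume "i \<in> R"
    then have *: "\<And>j. j \<in> C \<Longrightarrow> M i j = of_bool (M i j = 1)"
      using assms(1) by (auto simp: zero_one_filled_def)
    have "(\<Sum>j\<in>C. M i j) = (\<Sum>j\<in>C. of_bool (M i j = 1))"
      using * by (rule sum.cong[OF refl])
    also have "\<dots> = card {j\<in>C. M i j = 1}"
      using assms(3) by (simp add: Int_def)
    finally show "card {j\<in>C. M i j = 1} = (\<Sum>j\<in>C. M i j)" ..
  qed
  finally show ?thesis .
qed

text \<open>Each of the \<open>q\<close> blocks of \<open>m\<close> consecutive numbers below
  \<open>m * q\<close> holds exactly one number \<open>m * t + i\<close>, and \<open>p div m\<close>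
  recovers the block index \<open>t\<close>.\<close>

lemma card_residue_multiple:
  fixes m i q :: nat
  assumes "i < m"
  shows "card {p. p < m * q \<and> p mod m = i} = q"
proof -
  have "bij_betw (\<lambda>t. m * t + i) {..<q} {p. p < m * q \<and> p mod m = i}"
  proof (rule bij_betw_byWitness[where f' = "\<lambda>p. p div m"])
    show "(\<lambda>t. m * t + i) ` {..<q} \<subseteq> {p. p < m * q \<and> p mod m = i}"
    proof clarsimp
      fix t assume "t < q"
      then have "m * Suc t \<le> m * q"
        by (intro mult_le_mono2) simp
      with assms show "m * t + i < m * q \<and> i mod m = i"
        by simp
    qed
    show "(\<lambda>p. p div m) ` {p. p < m * q \<and> p mod m = i} \<subseteq> {..<q}"
      by (auto simp: less_mult_imp_div_less mult.commute)
  qed (use assms in auto)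
  then show ?thesis
    using bij_betw_same_card by fastforce
qed

text \<open>The count grows with \<open>N\<close>, so it is compared with the exact counts at the
  multiples \<open>m * lo\<close> and \<open>m * hi\<close> of \<open>m\<close>.\<close>

lemma card_residue_bounds:
  fixes m i N :: nat and lo hi :: int
  assumes "i < m" "int m * lo \<le> int N" "int N \<le> int m * hi"
  shows "lo \<le> int (card {p. p < N \<and> p mod m = i})"
    and "int (card {p. p < N \<and> p mod m = i}) \<le> hi"
proof -
  show "lo \<le> int (card {p. p < N \<and> p mod m = i})"
  proof (cases "0 \<le> lo")
    case True
    have "int (m * nat lo) \<le> int N"
      using True assms by simp
    then have "m * nat lo \<le> N"
      by (simp only: of_nat_le_iff)
    then have "card {p. p < m * nat lo \<and> p mod m = i} \<le> card {p. p < N \<and> p mod m = i}"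
      by (intro card_mono) auto
    then show ?thesis
      using card_residue_multiple[OF assms(1), of "nat lo"] True by simp
  qed simp
  \<comment> \<open>Needed so that \<open>nat hi\<close> does not truncate; a negative
    \<open>lo\<close>, by contrast, made the lower bound trivial.\<close>
  have hi: "0 \<le> hi"
  proof -
    have "0 \<le> int m * hi"
      using assms(3) of_nat_0_le_iff order_trans by blast
    then show ?thesis
      using assms(1) by (simp add: zero_le_mult_iff)
  qed
  then have "int N \<le> int (m * nat hi)"
    using assms by simp
  then have "N \<le> m * nat hi"
    by (simp only: of_nat_le_iff)
  then have "card {p. p < N \<and> p mod m = i} \<le> card {p. p < m * nat hi \<and> p mod m = i}"
    by (intro card_mono) auto
  then show "int (card {p. p < N \<and> p mod m = i}) \<le> hi"
    using card_residue_multiple[OF assms(1), of "nat hi"] hi by simp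
qed

text \<open>Distinct points of the interval differ by less than \<open>m\<close>, so they cannot be
  congruent. This is why the cyclic placement never uses a cell twice.\<close>

lemma inj_on_mod_interval:
  fixes a d m :: nat
  assumes "d \<le> m"
  shows "inj_on (\<lambda>p. p mod m) {a..<a + d}"
proof (rule linorder_inj_onI')
  fix x y assume xy: "x \<in> {a..<a + d}" "y \<in> {a..<a + d}" "x < y"
  show "x mod m \<noteq> y mod m"
  proof
    assume "x mod m = y mod m"
    then have "m dvd y - x"
      using xy by (metis mod_eq_dvd_iff_nat less_imp_le)
    then have "m \<le> y - x"
      using xy by (intro dvd_imp_le) auto
    then show False
      using xy assms by auto
  qed
qed

text \<open>Number all ones from 0, column after column, and put the one numbered \<open>p\<close>
  into row \<open>p mod m\<close>. A row sum then counts the numbers below the total in one residue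
  class.\<close>

lemma balanced_zero_one_matrix:
  fixes d :: "nat \<Rightarrow> nat" and m s :: nat and lo hi :: int
  assumes "0 < m" and d: "\<And>j. j \<in> {1..s} \<Longrightarrow> d j \<le> m"
    and "int m * lo \<le> int (\<Sum>j=1..s. d j)" "int (\<Sum>j=1..s. d j) \<le> int m * hi"
  obtains W :: "nat \<Rightarrow> nat \<Rightarrow> nat" where
    "\<And>i j. i < m \<Longrightarrow> j \<in> {1..s} \<Longrightarrow> W i j \<in> {0, 1}"
    "\<And>j. j \<in> {1..s} \<Longrightarrow> (\<Sum>i<m. W i j) = d j"
    "\<And>i. i < m \<Longrightarrow> lo \<le> int (\<Sum>j=1..s. W i j) \<and> int (\<Sum>j=1..s. W i j) \<le> hi"
proof
  \<comment> \<open>\<open>P j\<close> is the number of ones in the columns before \<open>j\<close>,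
    hence the number of the first one in column \<open>j\<close>; \<open>S i j\<close> collects the
    ones of that column that land in row \<open>i\<close>.\<close>
  define P where "P j = (\<Sum>t=1..<j. d t)" for j
  define S where "S i j = {p \<in> {P j..<P j + d j}. p mod m = i}" for i j
  define W where "W i j = card (S i j)" for i j
  show "W i j \<in> {0, 1}" if "i < m" "j \<in> {1..s}" for i j
  proof -
    have "card (S i j) \<le> 1"
      using inj_on_mod_interval[OF d[OF that(2)], of "P j"]
      by (subst card_le_Suc0_iff_eq[folded One_nat_def]) (auto simp: S_def inj_on_def)
    then show ?thesis by (auto simp: W_def)
  qed
  show "(\<Sum>i<m. W i j) = d j" if "j \<in> {1..s}" for j
  proof -
    have "(\<Sum>i<m. W i j) = card (\<Union>i<m. S i j)"
      unfolding W_def by (subst card_UN_disjoint) (auto simp: S_def)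
    also have "(\<Union>i<m. S i j) = {P j..<P j + d j}"
      using assms(1) by (auto simp: S_def)
    finally show ?thesis by simp
  qed
  \<comment> \<open>The intervals of the first \<open>t\<close> columns are adjacent and fill an
    initial segment of the naturals.\<close>
  have row: "(\<Sum>j=1..t. W i j) = card {p. p < (\<Sum>j=1..t. d j) \<and> p mod m = i}" for i t
  proof (induction t)
    case (Suc t)
    have P: "P (Suc t) = (\<Sum>j=1..t. d j)"
      by (simp add: P_def atLeastLessThanSuc_atLeastAtMost)
    have "{p. p < (\<Sum>j=1..Suc t. d j) \<and> p mod m = i}
        = {p. p < (\<Sum>j=1..t. d j) \<and> p mod m = i} \<union> S i (Suc t)"
      by (auto simp: S_def P)
    moreover have "{p. p < (\<Sum>j=1..t. d j) \<and> p mod m = i} \<inter> S i (Suc t) = {}"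
      by (auto simp: S_def P)
    ultimately show ?case
      using Suc.IH by (simp add: W_def S_def card_Un_disjoint)
  qed simp
  show "lo \<le> int (\<Sum>j=1..s. W i j) \<and> int (\<Sum>j=1..s. W i j) \<le> hi" if "i < m" for i
    unfolding row using card_residue_bounds[OF that assms(3,4)] by (rule conjI)
qed

theorem theorem1p6:
  fixes n r s :: nat and k :: int and A :: "nat \<Rightarrow> nat \<Rightarrow> nat"
  assumes "0 < n" and "0 < r" and "0 < s" and "r \<le> n" and "s \<le> n"
    and "zero_one_filled A {1..r} {1..s}"
    and "\<forall>i\<in>{1..r}. int s + k - int n \<le> int (num_ones A {i} {1..s})
                    \<and> int (num_ones A {i} {1..s}) \<le> k"
    and "\<forall>j\<in>{1..s}. int r + k - int n \<le> int (num_ones A {1..r} {j})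
                    \<and> int (num_ones A {1..r} {j}) \<le> k"
    and "(int r + int s - int n) * k \<le> int (num_ones A {1..r} {1..s})"
    and "int (num_ones A {1..r} {1..s}) \<le> int r * int s - (int n - k) * (int r + int s - int n)"
  shows "\<exists>M :: nat \<Rightarrow> nat \<Rightarrow> nat.
           (\<forall>i\<in>{1..r}. \<forall>j\<in>{1..s}. M i j = A i j)
         \<and> zero_one_filled M {r+1..n} {1..s}
         \<and> (\<forall>j\<in>{1..s}. int (num_ones M {1..n} {j}) = k)
         \<and> (\<forall>i\<in>{1..n}. int s + k - int n \<le> int (num_ones M {i} {1..s})
                        \<and> int (num_ones M {i} {1..s}) \<le> k)"
proof (cases "r = n")
  \<comment> \<open>There is no cell to fill, and the two column bounds both become
    \<open>k\<close>, so \<open>A\<close> itself works.\<close>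
  case True
  then show ?thesis
    using assms by (intro exI[of _ A]) (auto simp: zero_one_filled_def intro: antisym)
next
  case False
  define m where "m = n - r"
  have m: "0 < m" "n = r + m"
    using False assms by (auto simp: m_def)
  define c where "c j = (\<Sum>i=1..r. A i j)" for j
  have c: "num_ones A {1..r} {j} = c j" if "j \<in> {1..s}" for j
    using assms(6) that by (subst num_ones_eq_sum) (auto simp: zero_one_filled_def c_def)
  \<comment> \<open>The upper column bound makes the difference nonnegative, so \<open>nat\<close>
    loses nothing; the lower one gives \<open>d j \<le> m\<close>.\<close>
  define d where "d j = nat (k - int (c j))" for j
  have d: "int (d j) = k - int (c j)" "d j \<le> m" if "j \<in> {1..s}" for j
    using assms(8)[rule_format, OF that] c[OF that] m(2) by (auto simp: d_def)
  have "num_ones A {1..r} {1..s} = (\<Sum>j=1..s. c j)"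
    using assms(6) by (subst num_ones_eq_sum) (auto simp: c_def intro: sum.swap)
  then have total: "int (\<Sum>j=1..s. d j) = int s * k - int (num_ones A {1..r} {1..s})"
    by (simp add: d sum_subtractf)
  \<comment> \<open>Expanding with \<open>m = n - r\<close> turns this into condition 2, and the
    upper bound below into condition 1.\<close>
  have lower: "int m * (int s + k - int n) \<le> int (\<Sum>j=1..s. d j)"
    unfolding total using assms(10) m(2) by (simp add: algebra_simps)
  have upper: "int (\<Sum>j=1..s. d j) \<le> int m * k"
    unfolding total using assms(9) m(2) by (simp add: algebra_simps)
  obtain W :: "nat \<Rightarrow> nat \<Rightarrow> nat" where
    W01: "\<And>i j. i < m \<Longrightarrow> j \<in> {1..s} \<Longrightarrow> W i j \<in> {0, 1}"
    and Wcol: "\<And>j. j \<in> {1..s} \<Longrightarrow> (\<Sum>i<m. W i j) = d j"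
    and Wrow: "\<And>i. i < m \<Longrightarrow> int s + k - int n \<le> int (\<Sum>j=1..s. W i j)
                            \<and> int (\<Sum>j=1..s. W i j) \<le> k"
    by (rule balanced_zero_one_matrix[OF m(1) _ lower upper]) (erule d(2), rule that)
  \<comment> \<open>The rows of \<open>W\<close> are counted from 0, so row \<open>r + 1\<close> of
    the array is row 0 of \<open>W\<close>.\<close>
  define M where "M i j = (if i \<le> r then A i j else W (i - Suc r) j)" for i j
  have M01: "M i j \<in> {0, 1}" if "i \<in> {1..n}" "j \<in> {1..s}" for i j
  proof (cases "i \<le> r")
    case True
    then show ?thesis
      using assms(6) that by (simp add: M_def zero_one_filled_def)
  next
    case False
    then have "i - Suc r < m"
      using that m by auto
    then show ?thesis
      using W01 that False by (simp add: M_def)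
  qed
  then have filled: "zero_one_filled M R C" if "R \<subseteq> {1..n}" "C \<subseteq> {1..s}" for R C
    using that unfolding zero_one_filled_def by blast
  have col: "int (num_ones M {1..n} {j}) = k" if j: "j \<in> {1..s}" for j
  proof -
    have "num_ones M {1..n} {j} = (\<Sum>i=1..n. M i j)"
      using j by (subst num_ones_eq_sum[OF filled]) auto
    also have "\<dots> = (\<Sum>i=1..r. M i j) + (\<Sum>i=Suc r..n. M i j)"
      using m(2) sum.ub_add_nat[of 1 r "\<lambda>i. M i j" m] by simp
    also have "(\<Sum>i=1..r. M i j) = c j"
      by (simp add: M_def c_def)
    also have "(\<Sum>i=Suc r..n. M i j) = (\<Sum>i<m. W i j)"
      by (rule sum.reindex_bij_witness[of _ "\<lambda>i. i + Suc r" "\<lambda>i. i - Suc r"])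
        (use m in \<open>auto simp: M_def\<close>)
    finally show ?thesis
      using d(1)[OF j] Wcol[OF j] by simp
  qed
  have row: "int s + k - int n \<le> int (num_ones M {i} {1..s})
           \<and> int (num_ones M {i} {1..s}) \<le> k" if i: "i \<in> {1..n}" for i
  proof (cases "i \<le> r")
    case True
    then have "num_ones M {i} {1..s} = num_ones A {i} {1..s}"
      unfolding num_ones_def M_def by (intro arg_cong[of _ _ card]) auto
    then show ?thesis
      using True i assms(7) by simp
  next
    case False
    have "num_ones M {i} {1..s} = (\<Sum>j=1..s. M i j)"
      using i by (subst num_ones_eq_sum[OF filled]) auto
    also have "\<dots> = (\<Sum>j=1..s. W (i - Suc r) j)"
      using False by (simp add: M_def)
    finally show ?thesis
      using Wrow[of "i - Suc r"] False i m by auto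
  qed
  have "\<forall>i\<in>{1..r}. \<forall>j\<in>{1..s}. M i j = A i j"
    by (simp add: M_def)
  moreover have "zero_one_filled M {r+1..n} {1..s}"
    by (rule filled) auto
  ultimately show ?thesis
    using col row by (intro exI[of _ M] conjI ballI) simp_all
qed

end
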